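(* Let $K$ be a field and let $L_{11}$ be the three-dimensional Leibniz algebra over $K$ with basis $\{e_1,e_2,e_3\}$ and nonzero products of basis elements $e_1e_3=e_1$, $e_2e_3=e_2$. If $K$ is infinite, then the polynomial $x_1(x_2x_3)$ generates the $T$-ideal of polynomial identities of $L_{11}$. If $|K|=q<\infty$, then the $T$-ideal of polynomial identities of $L_{11}$ is generated by $x_1(x_2x_3)$ together with $x_1x_2^{(q)}-x_1x_2$.
   Context: A (right) Leibniz algebra over $K$ is a $K$-algebra satisfying $x(yz)=(xy)z-(xz)y$. Identities live in the free Leibniz algebra $\mathcal L\langle X\rangle$ over $K$ on $X=\{x_1,x_2,\dots\}$; the $T$-ideal of identities of $L$ is the set of polynomials vanishing under all substitutions of elements of $L$. A $T$-ideal is an ideal invariant under all endomorphisms of $\mathcal L\langle X\rangle$, and it is generated by $S$ if it is the smallest $T$-ideal containing $S$. Products without brackets are left-normed, and $x_1x_2^{(q)}$ is $x_1$ multiplied on the right $q$ times successively by $x_2$. Products of basis elements not listed are zero. *)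

theory Defs
  imports Complex_Main "HOL-Library.Poly_Mapping" "HOL-Library.Product_Plus"
begin

locale nonassoc_algebra = vector_space scale
  for scale :: "'k::field \<Rightarrow> 'a::ab_group_add \<Rightarrow> 'a" (infixr \<open>*s\<close> 75) +
  fixes mult :: "'a \<Rightarrow> 'a \<Rightarrow> 'a" (infixl \<open>\<star>\<close> 70)
  assumes mult_add_left: "(x + y) \<star> z = x \<star> z + y \<star> z"
    and mult_add_right: "x \<star> (y + z) = x \<star> y + x \<star> z"
    and mult_scale_left: "(c *s x) \<star> y = c *s (x \<star> y)"
    and mult_scale_right: "x \<star> (c *s y) = c *s (x \<star> y)"
begin

definition ideal :: "'a set \<Rightarrow> bool" where
  "ideal I \<longleftrightarrow> subspace I \<and> (\<forall>a\<in>I. \<forall>x. a \<star> x \<in> I \<and> x \<star> a \<in> I)"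

lemma mult_zero_left [simp]: "0 \<star> x = 0"
  using mult_add_left[of 0 0 x] by simp

lemma mult_zero_right [simp]: "x \<star> 0 = 0"
  using mult_add_right[of x 0 0] by simp

lemma mult_minus_left [simp]: "(- x) \<star> y = - (x \<star> y)"
  using mult_add_left[of x "- x" y] by (simp add: eq_neg_iff_add_eq_0 add.commute)

lemma mult_minus_right [simp]: "x \<star> (- y) = - (x \<star> y)"
  using mult_add_right[of x y "- y"] by (simp add: eq_neg_iff_add_eq_0 add.commute)

lemma mult_diff_left: "(x - y) \<star> z = x \<star> z - y \<star> z"
  using mult_add_left[of x "- y" z] by simp

lemma mult_diff_right: "x \<star> (y - z) = x \<star> y - x \<star> z"
  using mult_add_right[of x y "- z"] by simp

lemma mult_sum_left: "sum f A \<star> y = (\<Sum>a\<in>A. f a \<star> y)"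
  by (induction A rule: infinite_finite_induct) (auto simp: mult_add_left)

lemma mult_sum_right: "y \<star> sum f A = (\<Sum>a\<in>A. y \<star> f a)"
  by (induction A rule: infinite_finite_induct) (auto simp: mult_add_right)

lemma ideal_hull: "ideal (ideal hull S)"
  by (rule hull_in) (auto simp: ideal_def intro!: subspace_Inter)

end

locale leibniz_algebra = nonassoc_algebra scale mult
  for scale :: "'k::field \<Rightarrow> 'a::ab_group_add \<Rightarrow> 'a" (infixr \<open>*s\<close> 75)
    and mult :: "'a \<Rightarrow> 'a \<Rightarrow> 'a" (infixl \<open>\<star>\<close> 70) +
  assumes leibniz: "x \<star> (y \<star> z) = (x \<star> y) \<star> z - (x \<star> z) \<star> y"

definition alg_hom ::
  "('k::field \<Rightarrow> 'a::ab_group_add \<Rightarrow> 'a) \<Rightarrow> ('a \<Rightarrow> 'a \<Rightarrow> 'a) \<Rightarrow>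
   ('k \<Rightarrow> 'b::ab_group_add \<Rightarrow> 'b) \<Rightarrow> ('b \<Rightarrow> 'b \<Rightarrow> 'b) \<Rightarrow> ('a \<Rightarrow> 'b) \<Rightarrow> bool" where
  "alg_hom s1 m1 s2 m2 f \<longleftrightarrow>
     Vector_Spaces.linear s1 s2 f \<and> (\<forall>x y. f (m1 x y) = m2 (f x) (f y))"

datatype magma = Gen nat | Mul magma magma

definition na_scale :: "'k::field \<Rightarrow> (magma \<Rightarrow>\<^sub>0 'k) \<Rightarrow> (magma \<Rightarrow>\<^sub>0 'k)" where
  "na_scale c p = Poly_Mapping.map ((*) c) p"

text \<open>The type \<open>magma \<Rightarrow>\<^sub>0 'k\<close> consists of the finitely supported functions, i.e. the linear
  combinations of nonassociative monomials; the product extends \<^const>\<open>Mul\<close> bilinearly.\<close>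

definition na_mult :: "(magma \<Rightarrow>\<^sub>0 'k::field) \<Rightarrow> (magma \<Rightarrow>\<^sub>0 'k) \<Rightarrow> (magma \<Rightarrow>\<^sub>0 'k)" where
  "na_mult p q = (\<Sum>m\<in>Poly_Mapping.keys p. \<Sum>n\<in>Poly_Mapping.keys q.
     Poly_Mapping.single (Mul m n) (Poly_Mapping.lookup p m * Poly_Mapping.lookup q n))"

lemma lookup_na_scale [simp]:
  "Poly_Mapping.lookup (na_scale c p) m = c * Poly_Mapping.lookup p m"
  unfolding na_scale_def by transfer (simp add: when_def)

lemma na_mult_superset:
  assumes "finite A" "finite B" "Poly_Mapping.keys p \<subseteq> A" "Poly_Mapping.keys q \<subseteq> B"
  shows "na_mult p q = (\<Sum>m\<in>A. \<Sum>n\<in>B.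
    Poly_Mapping.single (Mul m n) (Poly_Mapping.lookup p m * Poly_Mapping.lookup q n))"
proof -
  have "(\<Sum>n\<in>Poly_Mapping.keys q.
      Poly_Mapping.single (Mul m n) (Poly_Mapping.lookup p m * Poly_Mapping.lookup q n))
    = (\<Sum>n\<in>B. Poly_Mapping.single (Mul m n) (Poly_Mapping.lookup p m * Poly_Mapping.lookup q n))"
    for m
    using assms by (intro sum.mono_neutral_left) (auto simp: in_keys_iff)
  then show ?thesis
    unfolding na_mult_def
    using assms by (auto intro!: sum.mono_neutral_left simp: in_keys_iff)
qed

interpretation na: nonassoc_algebra "na_scale :: 'k::field \<Rightarrow> _" na_mult
proof
  fix a b :: 'k and x y z :: "magma \<Rightarrow>\<^sub>0 'k"
  show "na_scale a (x + y) = na_scale a x + na_scale a y"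
    by (rule poly_mapping_eqI) (simp add: lookup_add algebra_simps)
  show "na_scale (a + b) x = na_scale a x + na_scale b x"
    by (rule poly_mapping_eqI) (simp add: lookup_add algebra_simps)
  show "na_scale a (na_scale b x) = na_scale (a * b) x"
    by (rule poly_mapping_eqI) (simp add: algebra_simps)
  show "na_scale 1 x = x"
    by (rule poly_mapping_eqI) simp
  have scale_single: "na_scale c (Poly_Mapping.single m d) = Poly_Mapping.single m (c * d)"
    for c d :: 'k and m
    by (rule poly_mapping_eqI) (simp add: lookup_single when_def)
  have scale_add: "na_scale c (p + q) = na_scale c p + na_scale c q"
    for c :: 'k and p q
    by (rule poly_mapping_eqI) (simp add: lookup_add algebra_simps)
  have scale_sum: "na_scale c (sum f A) = (\<Sum>i\<in>A. na_scale c (f i))"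
    for c :: 'k and f :: "magma \<Rightarrow> _" and A
    by (induction A rule: infinite_finite_induct)
      (auto simp: scale_add intro: poly_mapping_eqI)
  let ?A = "Poly_Mapping.keys x \<union> Poly_Mapping.keys y \<union> Poly_Mapping.keys z"
  have fin: "finite ?A" by simp
  have k: "Poly_Mapping.keys x \<subseteq> ?A" "Poly_Mapping.keys y \<subseteq> ?A" "Poly_Mapping.keys z \<subseteq> ?A"
    "Poly_Mapping.keys (x + y) \<subseteq> ?A" "Poly_Mapping.keys (y + z) \<subseteq> ?A"
    "Poly_Mapping.keys (na_scale a x) \<subseteq> ?A" "Poly_Mapping.keys (na_scale a y) \<subseteq> ?A"
    by (auto simp: in_keys_iff lookup_add)
  note sup = na_mult_superset[OF fin fin]
  show "na_mult (x + y) z = na_mult x z + na_mult y z"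
    by (simp add: sup k lookup_add distrib_right single_add sum.distrib)
  show "na_mult x (y + z) = na_mult x y + na_mult x z"
    by (simp add: sup k lookup_add distrib_left single_add sum.distrib)
  show "na_mult (na_scale a x) y = na_scale a (na_mult x y)"
    by (simp add: sup k scale_sum scale_single mult.assoc)
  show "na_mult x (na_scale a y) = na_scale a (na_mult x y)"
    by (simp add: sup k scale_sum scale_single mult.left_commute)
qed

lemma na_mult_single:
  "na_mult (Poly_Mapping.single m c) (Poly_Mapping.single n d) = Poly_Mapping.single (Mul m n) (c * d)"
  by (subst na_mult_superset[of "{m}" "{n}"]) (auto simp: lookup_single)

lemma na_expand:
  "p = (\<Sum>m\<in>Poly_Mapping.keys p. na_scale (Poly_Mapping.lookup p m) (Poly_Mapping.single m 1))"
  by (rule poly_mapping_eqI) (auto simp: lookup_sum lookup_single when_def in_keys_iff if_distrib sum.delta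
      cong: if_cong)

context nonassoc_algebra
begin

primrec eval_magma :: "(nat \<Rightarrow> 'a) \<Rightarrow> magma \<Rightarrow> 'a" where
  "eval_magma \<sigma> (Gen i) = \<sigma> i"
| "eval_magma \<sigma> (Mul m n) = eval_magma \<sigma> m \<star> eval_magma \<sigma> n"

definition eval_na :: "(nat \<Rightarrow> 'a) \<Rightarrow> (magma \<Rightarrow>\<^sub>0 'k) \<Rightarrow> 'a" where
  "eval_na \<sigma> p = (\<Sum>m\<in>Poly_Mapping.keys p. Poly_Mapping.lookup p m *s eval_magma \<sigma> m)"

lemma eval_na_superset:
  assumes "finite A" "Poly_Mapping.keys p \<subseteq> A"
  shows "eval_na \<sigma> p = (\<Sum>m\<in>A. Poly_Mapping.lookup p m *s eval_magma \<sigma> m)"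
  unfolding eval_na_def using assms by (intro sum.mono_neutral_left) (auto simp: in_keys_iff)

lemma eval_na_add: "eval_na \<sigma> (p + q) = eval_na \<sigma> p + eval_na \<sigma> q"
proof -
  let ?A = "Poly_Mapping.keys p \<union> Poly_Mapping.keys q"
  have "Poly_Mapping.keys (p + q) \<subseteq> ?A"
    by (auto simp: in_keys_iff lookup_add)
  then show ?thesis
    by (simp add: eval_na_superset[of ?A] lookup_add scale_left_distrib sum.distrib)
qed

lemma eval_na_scale: "eval_na \<sigma> (na_scale c p) = c *s eval_na \<sigma> p"
proof -
  have "Poly_Mapping.keys (na_scale c p) \<subseteq> Poly_Mapping.keys p"
    by (auto simp: in_keys_iff)
  then show ?thesis
    by (simp add: eval_na_superset[of "Poly_Mapping.keys p"] scale_sum_right)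
qed

lemma eval_na_single: "eval_na \<sigma> (Poly_Mapping.single m c) = c *s eval_magma \<sigma> m"
  by (subst eval_na_superset[of "{m}"]) (auto simp: lookup_single)

lemma eval_na_zero [simp]: "eval_na \<sigma> 0 = 0"
  by (simp add: eval_na_def)

lemma eval_na_sum: "eval_na \<sigma> (sum f A) = (\<Sum>i\<in>A. eval_na \<sigma> (f i))"
  by (induction A rule: infinite_finite_induct) (auto simp: eval_na_add)

lemma eval_na_diff: "eval_na \<sigma> (p - q) = eval_na \<sigma> p - eval_na \<sigma> q"
  using eval_na_add[of \<sigma> "p - q" q] by (simp add: algebra_simps)

lemma eval_na_mult: "eval_na \<sigma> (na_mult p q) = eval_na \<sigma> p \<star> eval_na \<sigma> q"
proof -
  have "eval_na \<sigma> p \<star> eval_na \<sigma> q = (\<Sum>m\<in>Poly_Mapping.keys p. \<Sum>n\<in>Poly_Mapping.keys q.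
      (Poly_Mapping.lookup p m *s eval_magma \<sigma> m) \<star> (Poly_Mapping.lookup q n *s eval_magma \<sigma> n))"
    unfolding eval_na_def mult_sum_left mult_sum_right by (rule sum.swap)
  then show ?thesis
    by (simp add: na_mult_def eval_na_sum eval_na_single mult_scale_left mult_scale_right mult.commute)
qed

end

definition leibniz_ideal :: "(magma \<Rightarrow>\<^sub>0 'k::field) set" where
  "leibniz_ideal = nonassoc_algebra.ideal na_scale na_mult hull
     {na_mult x (na_mult y z) - (na_mult (na_mult x y) z - na_mult (na_mult x z) y) | x y z. True}"

definition leibniz_rel :: "(magma \<Rightarrow>\<^sub>0 'k::field) \<Rightarrow> (magma \<Rightarrow>\<^sub>0 'k) \<Rightarrow> bool" where
  "leibniz_rel p q \<longleftrightarrow> p - q \<in> leibniz_ideal"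

lemma ideal_leibniz_ideal: "na.ideal leibniz_ideal"
  unfolding leibniz_ideal_def by (rule na.ideal_hull)

lemma subspace_leibniz_ideal: "na.subspace leibniz_ideal"
  by (rule na.ideal_def[THEN iffD1, THEN conjunct1, OF ideal_leibniz_ideal])

lemma equivp_leibniz_rel: "equivp leibniz_rel"
proof (rule equivpI)
  note s = subspace_leibniz_ideal
  show "reflp leibniz_rel"
    by (auto simp: reflp_def leibniz_rel_def na.subspace_0[OF s])
  show "symp leibniz_rel"
    using na.subspace_neg[OF s] by (fastforce simp: symp_def leibniz_rel_def)
  show "transp leibniz_rel"
    using na.subspace_add[OF s] by (fastforce simp: transp_def leibniz_rel_def)
qed

quotient_type (overloaded) 'k free_leibniz = "magma \<Rightarrow>\<^sub>0 ('k::field)" / leibniz_rel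
  by (rule equivp_leibniz_rel)

instantiation free_leibniz :: (field) ab_group_add
begin

lift_definition zero_free_leibniz :: "'a free_leibniz" is 0 .

lift_definition plus_free_leibniz :: "'a free_leibniz \<Rightarrow> 'a free_leibniz \<Rightarrow> 'a free_leibniz" is "(+)"
  using na.subspace_add[OF subspace_leibniz_ideal]
  by (fastforce simp: leibniz_rel_def algebra_simps)

lift_definition minus_free_leibniz :: "'a free_leibniz \<Rightarrow> 'a free_leibniz \<Rightarrow> 'a free_leibniz" is "(-)"
proof -
  fix p p' q q' :: "magma \<Rightarrow>\<^sub>0 'a"
  assume "leibniz_rel p p'" "leibniz_rel q q'"
  then have "(p - p') - (q - q') \<in> leibniz_ideal"
    unfolding leibniz_rel_def by (rule na.subspace_diff[OF subspace_leibniz_ideal])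
  then show "leibniz_rel (p - q) (p' - q')"
    by (simp add: leibniz_rel_def algebra_simps)
qed

lift_definition uminus_free_leibniz :: "'a free_leibniz \<Rightarrow> 'a free_leibniz" is uminus
  using na.subspace_neg[OF subspace_leibniz_ideal]
  by (fastforce simp: leibniz_rel_def)

instance
proof
  fix a b c :: "'a free_leibniz"
  have r: "leibniz_rel p p" for p :: "magma \<Rightarrow>\<^sub>0 'a"
    using equivp_leibniz_rel by (rule equivp_reflp)
  show "a + b + c = a + (b + c)" by transfer (simp add: add.assoc r)
  show "a + b = b + a" by transfer (simp add: add.commute r)
  show "0 + a = a" by transfer (simp add: r)
  show "- a + a = 0" by transfer (simp add: r)
  show "a - b = a + - b" by transfer (simp add: r)
qed

end

instantiation free_leibniz :: (field) times
begin

lift_definition times_free_leibniz :: "'a free_leibniz \<Rightarrow> 'a free_leibniz \<Rightarrow> 'a free_leibniz"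
  is na_mult
proof -
  fix p p' q q' :: "magma \<Rightarrow>\<^sub>0 'a"
  assume "leibniz_rel p p'" "leibniz_rel q q'"
  then have "na_mult (p - p') q \<in> leibniz_ideal" "na_mult p' (q - q') \<in> leibniz_ideal"
    using ideal_leibniz_ideal by (auto simp: leibniz_rel_def na.ideal_def)
  then have "na_mult (p - p') q + na_mult p' (q - q') \<in> leibniz_ideal"
    by (rule na.subspace_add[OF subspace_leibniz_ideal])
  then show "leibniz_rel (na_mult p q) (na_mult p' q')"
    by (simp add: leibniz_rel_def na.mult_diff_left na.mult_diff_right)
qed

instance ..

end

lift_definition fl_scale :: "'k::field \<Rightarrow> 'k free_leibniz \<Rightarrow> 'k free_leibniz" is na_scale
proof -
  fix c :: 'k and p p' :: "magma \<Rightarrow>\<^sub>0 'k"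
  assume "leibniz_rel p p'"
  then have "na_scale c (p - p') \<in> leibniz_ideal"
    unfolding leibniz_rel_def by (rule na.subspace_scale[OF subspace_leibniz_ideal])
  then show "leibniz_rel (na_scale c p) (na_scale c p')"
    by (simp add: leibniz_rel_def na.scale_right_diff_distrib)
qed

text \<open>The free generators are indexed from \<open>0\<close>: \<open>gen i\<close> is the variable \<open>x\<^bsub>i+1\<^esub>\<close>.\<close>

lift_definition gen :: "nat \<Rightarrow> 'k::field free_leibniz" is "\<lambda>i. Poly_Mapping.single (Gen i) 1" .

interpretation fl: leibniz_algebra "fl_scale :: 'k::field \<Rightarrow> _" "(*)"
proof
  fix a b :: 'k and x y z :: "'k free_leibniz"
  have r: "leibniz_rel p p" for p :: "magma \<Rightarrow>\<^sub>0 'k"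
    using equivp_leibniz_rel by (rule equivp_reflp)
  show "fl_scale a (x + y) = fl_scale a x + fl_scale a y"
    by transfer (simp add: na.scale_right_distrib r)
  show "fl_scale (a + b) x = fl_scale a x + fl_scale b x"
    by transfer (simp add: na.scale_left_distrib r)
  show "fl_scale a (fl_scale b x) = fl_scale (a * b) x"
    by transfer (simp add: r)
  show "fl_scale 1 x = x"
    by transfer (simp add: r)
  show "(x + y) * z = x * z + y * z"
    by transfer (simp add: na.mult_add_left r)
  show "x * (y + z) = x * y + x * z"
    by transfer (simp add: na.mult_add_right r)
  show "fl_scale a x * y = fl_scale a (x * y)"
    by transfer (simp add: na.mult_scale_left r)
  show "x * fl_scale a y = fl_scale a (x * y)"
    by transfer (simp add: na.mult_scale_right r)
  show "x * (y * z) = x * y * z - x * z * y"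
  proof (transfer, unfold leibniz_rel_def)
    fix x y z :: "magma \<Rightarrow>\<^sub>0 'k"
    show "na_mult x (na_mult y z) - (na_mult (na_mult x y) z - na_mult (na_mult x z) y) \<in> leibniz_ideal"
      unfolding leibniz_ideal_def by (rule hull_inc) auto
  qed
qed

context nonassoc_algebra
begin

text \<open>The value of \<open>f\<close> under \<open>x\<^bsub>i+1\<^esub> \<mapsto> \<sigma> i\<close>, computed on a representative of \<open>f\<close>. In a Leibniz
  algebra the choice of the representative is irrelevant, see \<open>subst_abs\<close> below.\<close>

definition subst :: "(nat \<Rightarrow> 'a) \<Rightarrow> 'k free_leibniz \<Rightarrow> 'a" where
  "subst \<sigma> f = eval_na \<sigma> (rep_free_leibniz f)"

definition identities :: "'k free_leibniz set" where
  "identities = {f. \<forall>\<sigma>. subst \<sigma> f = 0}"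

end

context leibniz_algebra
begin

lemma eval_na_leibniz_ideal:
  assumes "p \<in> leibniz_ideal"
  shows "eval_na \<sigma> p = 0"
  using assms unfolding leibniz_ideal_def
proof (rule hull_induct)
  show "na.ideal {p. eval_na \<sigma> p = 0}"
    by (auto simp: na.ideal_def na.subspace_def eval_na_add eval_na_scale eval_na_mult)
qed (auto simp: eval_na_diff eval_na_mult leibniz)

lemma subst_abs: "subst \<sigma> (abs_free_leibniz p) = eval_na \<sigma> p"
proof -
  have "leibniz_rel (rep_free_leibniz (abs_free_leibniz p)) p"
    by (simp add: Quotient3_rep_abs[OF Quotient3_free_leibniz] equivp_reflp[OF equivp_leibniz_rel])
  then show ?thesis
    using eval_na_leibniz_ideal[of "rep_free_leibniz (abs_free_leibniz p) - p" \<sigma>]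
    by (simp add: subst_def leibniz_rel_def eval_na_diff)
qed

lemma subst_gen: "subst \<sigma> (gen i) = \<sigma> i"
  by (simp add: gen.abs_eq subst_abs eval_na_single)

lemma alg_hom_subst: "alg_hom fl_scale (*) scale (\<star>) (subst \<sigma>)"
proof -
  have "subst \<sigma> (x + y) = subst \<sigma> x + subst \<sigma> y" for x y
    by (induct x rule: free_leibniz.abs_induct; induct y rule: free_leibniz.abs_induct) (simp add: plus_free_leibniz.abs_eq subst_abs eval_na_add)
  moreover have "subst \<sigma> (fl_scale c x) = c *s subst \<sigma> x" for c x
    by (induct x rule: free_leibniz.abs_induct) (simp add: fl_scale.abs_eq subst_abs eval_na_scale)
  moreover have "subst \<sigma> (x * y) = subst \<sigma> x \<star> subst \<sigma> y" for x y
    by (induct x rule: free_leibniz.abs_induct; induct y rule: free_leibniz.abs_induct) (simp add: times_free_leibniz.abs_eq subst_abs eval_na_mult)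
  ultimately show ?thesis
    by (auto simp: alg_hom_def intro!: Vector_Spaces.linear.intro module_hom.intro
        module_hom_axioms.intro fl.vector_space_axioms vector_space_axioms
        fl.module_axioms module_axioms)
qed

lemma alg_hom_unique:
  assumes "alg_hom fl_scale (*) scale (\<star>) \<phi>" and "\<And>i. \<phi> (gen i) = \<sigma> i"
  shows "\<phi> = subst \<sigma>"
proof
  fix f :: "'k free_leibniz"
  interpret \<phi>: Vector_Spaces.linear fl_scale scale \<phi>
    using assms by (simp add: alg_hom_def)
  have mult: "\<phi> (x * y) = \<phi> x \<star> \<phi> y" for x y
    using assms by (simp add: alg_hom_def)
  have mon: "\<phi> (abs_free_leibniz (Poly_Mapping.single m 1)) = eval_magma \<sigma> m" for m
  proof (induction m)
    case (Gen i)
    show ?case using assms(2)[of i] by (simp add: gen.abs_eq)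
  next
    case (Mul m n)
    have "abs_free_leibniz (Poly_Mapping.single (Mul m n) 1)
      = abs_free_leibniz (Poly_Mapping.single m 1) * abs_free_leibniz (Poly_Mapping.single n (1 :: 'k))"
      by (simp add: times_free_leibniz.abs_eq na_mult_single)
    then show ?case by (simp add: mult Mul)
  qed
  have abs_sum: "abs_free_leibniz (sum g A) = (\<Sum>m\<in>A. abs_free_leibniz (g m))"
    for g :: "magma \<Rightarrow> magma \<Rightarrow>\<^sub>0 'k" and A
    by (induction A rule: infinite_finite_induct)
      (auto simp: zero_free_leibniz_def plus_free_leibniz.abs_eq[symmetric])
  obtain p where f: "f = abs_free_leibniz p" by (induct f rule: free_leibniz.abs_induct) auto
  have "\<phi> (abs_free_leibniz p) = eval_na \<sigma> p"
    by (subst na_expand)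
      (simp add: abs_sum fl_scale.abs_eq[symmetric] \<phi>.sum \<phi>.scale mon eval_na_def)
  then show "\<phi> f = subst \<sigma> f" by (simp add: f subst_abs)
qed

end

definition T_ideal :: "'k::field free_leibniz set \<Rightarrow> bool" where
  "T_ideal I \<longleftrightarrow> nonassoc_algebra.ideal fl_scale (*) I \<and>
     (\<forall>\<phi>. alg_hom fl_scale (*) fl_scale (*) \<phi> \<longrightarrow> \<phi> ` I \<subseteq> I)"

definition T_ideal_generated :: "'k::field free_leibniz set \<Rightarrow> 'k free_leibniz set" where
  "T_ideal_generated S = T_ideal hull S"

lemma T_ideal_T_ideal_generated: "T_ideal (T_ideal_generated S)"
  unfolding T_ideal_generated_def
proof (rule hull_in)
  fix \<T> :: "'a free_leibniz set set"
  assume *: "Ball \<T> T_ideal"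
  have "fl.ideal (\<Inter>\<T>)"
    using * by (auto simp: T_ideal_def fl.ideal_def intro!: fl.subspace_Inter)
  moreover have "\<phi> ` \<Inter>\<T> \<subseteq> \<Inter>\<T>" if "alg_hom fl_scale (*) fl_scale (*) \<phi>" for \<phi>
    using * that by (fastforce simp: T_ideal_def)
  ultimately show "T_ideal (\<Inter>\<T>)"
    by (simp add: T_ideal_def)
qed

text \<open>The left-normed product \<open>x y\<^sup>(\<^sup>q\<^sup>)\<close>.\<close>

definition right_power :: "'k::field free_leibniz \<Rightarrow> nat \<Rightarrow> 'k free_leibniz \<Rightarrow> 'k free_leibniz" where
  "right_power x q y = ((\<lambda>z. z * y) ^^ q) x"

locale L11 = leibniz_algebra scale mult
  for scale :: "'k::field \<Rightarrow> 'a::ab_group_add \<Rightarrow> 'a" (infixr \<open>*s\<close> 75)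
    and mult :: "'a \<Rightarrow> 'a \<Rightarrow> 'a" (infixl \<open>\<star>\<close> 70) +
  fixes e1 e2 e3 :: 'a
  assumes distinct_basis: "distinct [e1, e2, e3]"
    and independent_basis: "independent {e1, e2, e3}"
    and span_basis: "span {e1, e2, e3} = UNIV"
    and e1_products: "e1 \<star> e1 = 0" "e1 \<star> e2 = 0" "e1 \<star> e3 = e1"
    and e2_products: "e2 \<star> e1 = 0" "e2 \<star> e2 = 0" "e2 \<star> e3 = e2"
    and e3_products: "e3 \<star> e1 = 0" "e3 \<star> e2 = 0" "e3 \<star> e3 = 0"

lemma L11_exists:
  "L11 (\<lambda>c (x, y, z). (c * x, c * y, c * z))
     (\<lambda>(x, y, z) (x', y', z'). (x * z', y * z', 0))
     (1, 0, 0) (0, 1, 0) (0, 0, 1 :: 'k::field)"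
  (is "L11 ?s ?m ?e1 ?e2 ?e3")
proof -
  interpret leibniz_algebra ?s ?m
    by unfold_locales (auto simp: algebra_simps zero_prod_def)
  have "span {?e1, ?e2, ?e3} = UNIV"
  proof -
    have "?s x ?e1 + (?s y ?e2 + ?s z ?e3) \<in> span {?e1, ?e2, ?e3}" for x y z :: 'k
      by (intro span_add span_scale span_base) auto
    then have "(x, y, z) \<in> span {?e1, ?e2, ?e3}" for x y z
      by simp
    then show ?thesis by auto
  qed
  moreover have "independent {?e1, ?e2, ?e3}"
    unfolding dependent_finite[OF finite.insertI[OF finite.insertI[OF finite.insertI[OF finite.emptyI]]]]
    by (auto simp: zero_prod_def)
  ultimately show ?thesis
    by unfold_locales (auto simp: zero_prod_def)
qed

end

theory Submission
  imports Defs "HOL-Library.Multiset" "HOL-Computational_Algebra.Polynomial"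
begin

text \<open>
  Modulo \<open>x(yz)\<close> the Leibniz identity reads \<open>(xy)z = (xz)y\<close>, so every polynomial is congruent to a
  linear combination of left-normed monomials, each determined by its leading variable \<open>x\<^sub>i\<close> and the
  multiset \<open>M\<close> of the remaining ones. Substituting \<open>e\<^sub>1 + c\<^sub>i e\<^sub>3\<close> for \<open>x\<^sub>i\<close> and \<open>c\<^sub>j e\<^sub>3\<close> for the other
  variables, and multiplying by \<open>e\<^sub>3\<close>, turns the monomial \<open>(i, M)\<close> into \<open>(\<Prod>j\<in>#M. c\<^sub>j) e\<^sub>1\<close> and
  kills the monomials led by another variable. The functions \<open>c \<mapsto> \<Prod>j\<in>#M. c\<^sub>j\<close> are multiplicative in \<open>c\<close>,
  hence distinct ones are linearly independent (Dedekind). It remains to see that monomials with the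
  same leading variable and the same function are congruent: over an infinite field the function
  determines \<open>M\<close>, and over a field with \<open>q\<close> elements it does so once all multiplicities are below \<open>q\<close>,
  which \<open>x\<^sub>1x\<^sub>2\<^sup>(\<^sup>q\<^sup>) = x\<^sub>1x\<^sub>2\<close> allows one to assume.
\<close>

section \<open>Multiplicative functions and powers in a field\<close>

text \<open>Dedekind's independence of characters, by induction on the number of functions.\<close>

lemma multiplicative_functions_independent:
  fixes op :: "'m \<Rightarrow> 'm \<Rightarrow> 'm" and g :: "('m \<Rightarrow> 'k::field) \<Rightarrow> 'k"
  assumes "finite A"
    and "\<And>\<chi> x y. \<chi> \<in> A \<Longrightarrow> \<chi> (op x y) = \<chi> x * \<chi> y"
    and "\<And>\<chi>. \<chi> \<in> A \<Longrightarrow> \<exists>x. \<chi> x \<noteq> 0"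
    and "\<And>x. (\<Sum>\<chi>\<in>A. g \<chi> * \<chi> x) = 0"
    and "\<chi> \<in> A"
  shows "g \<chi> = 0"
  using assms
proof (induction A arbitrary: g \<chi> rule: finite_induct)
  case (insert \<chi>0 A)
  have zero: "g \<chi> = 0" if \<chi>: "\<chi> \<in> A" for \<chi>
  proof -
    have ne: "\<chi> \<noteq> \<chi>0" using \<chi> insert.hyps by auto
    then obtain y where y: "\<chi> y \<noteq> \<chi>0 y" by auto
    \<comment> \<open>The relation at \<open>op x y\<close> minus \<open>\<chi>0 y\<close> times the
      one at \<open>x\<close> has no \<open>\<chi>0\<close> term, while the choice of
      \<open>y\<close> keeps the factor at \<open>\<chi>\<close> nonzero.\<close>
    have "g \<chi> * (\<chi> y - \<chi>0 y) = 0"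
    proof (rule insert.IH[where g = "\<lambda>\<chi>. g \<chi> * (\<chi> y - \<chi>0 y)"])
      fix x
      have "0 = (\<Sum>\<chi>\<in>insert \<chi>0 A. g \<chi> * \<chi> (op x y)) - \<chi>0 y * (\<Sum>\<chi>\<in>insert \<chi>0 A. g \<chi> * \<chi> x)"
        using insert.prems(3) by simp
      also have "\<dots> = (\<Sum>\<chi>\<in>insert \<chi>0 A. g \<chi> * \<chi> (op x y) - \<chi>0 y * (g \<chi> * \<chi> x))"
        by (simp only: sum_subtractf sum_distrib_left)
      also have "\<dots> = (\<Sum>\<chi>\<in>insert \<chi>0 A. g \<chi> * (\<chi> y - \<chi>0 y) * \<chi> x)"
        by (rule sum.cong[OF refl]) (simp add: insert.prems(1) algebra_simps)
      also have "\<dots> = (\<Sum>\<chi>\<in>A. g \<chi> * (\<chi> y - \<chi>0 y) * \<chi> x)"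
        using insert.hyps by simp
      finally show "(\<Sum>\<chi>\<in>A. g \<chi> * (\<chi> y - \<chi>0 y) * \<chi> x) = 0" by simp
    qed (use insert.prems \<chi> in auto)
    then show ?thesis using y by simp
  qed
  obtain x where "\<chi>0 x \<noteq> 0" using insert.prems(2) by blast
  moreover have "g \<chi>0 * \<chi>0 x = 0"
    using insert.prems(3)[of x] insert.hyps zero by simp
  ultimately show ?case using zero insert.prems(4) by auto
qed simp

text \<open>Multiplication by a nonzero \<open>x\<close> permutes the nonzero elements, so the
  factor \<open>x ^ card ?U\<close> that their product acquires equals 1.\<close>

lemma power_card_UNIV_eq_same:
  fixes x :: "'k::field"
  assumes fin: "finite (UNIV :: 'k set)"
  shows "x ^ card (UNIV :: 'k set) = x"
proof (cases "x = 0")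
  case True
  then show ?thesis using fin by (simp add: card_gt_0_iff)
next
  case False
  let ?U = "UNIV - {0 :: 'k}"
  have "(\<Prod>y\<in>?U. x * y) = \<Prod>?U"
    by (rule prod.reindex_bij_witness[of _ "\<lambda>y. y / x" "\<lambda>y. x * y"]) (use False in auto)
  then have "x ^ card ?U * \<Prod>?U = \<Prod>?U"
    by (simp add: prod.distrib)
  moreover have "\<Prod>?U \<noteq> 0" using fin by simp
  ultimately have "x ^ card ?U = 1" by simp
  moreover have "card (UNIV :: 'k set) = Suc (card ?U)"
    using fin by (metis card.remove UNIV_I)
  ultimately show ?thesis by (simp only: power_Suc mult_1_right)
qed

text \<open>The monomials X^a and X^b agree at more points than their degrees, hence are the same
  polynomial.\<close>

lemma power_functions_eqD:
  fixes a b :: nat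
  assumes "infinite (UNIV :: 'k::field set) \<or> a < card (UNIV :: 'k set) \<and> b < card (UNIV :: 'k set)"
    and eq: "\<And>z :: 'k. z ^ a = z ^ b"
  shows "a = b"
proof -
  obtain A :: "'k set" where A: "card A > a" "card A > b"
  proof (cases "infinite (UNIV :: 'k set)")
    case True
    then obtain A :: "'k set" where "card A = Suc (a + b)"
      using infinite_arbitrarily_large by blast
    then show ?thesis using that[of A] by simp
  qed (use assms that in blast)
  have "monom (1 :: 'k) a = monom 1 b"
    by (rule poly_eqI_degree[where A = A]) (use A eq in \<open>auto simp: poly_monom degree_monom_eq\<close>)
  then show ?thesis
    by (metis degree_monom_eq one_neq_zero)
qed

definition mset_weight :: "('i \<Rightarrow> 'k::comm_monoid_mult) \<Rightarrow> 'i multiset \<Rightarrow> 'k" where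
  "mset_weight c M = (\<Prod>j\<in>#M. c j)"

lemma mset_weight_simps [simp]:
  "mset_weight c {#} = 1"
  "mset_weight c (add_mset j M) = c j * mset_weight c M"
  "mset_weight c (M + N) = mset_weight c M * mset_weight c N"
  "mset_weight c (replicate_mset n j) = c j ^ n"
  by (simp_all add: mset_weight_def)

lemma mset_weight_mult: "mset_weight (\<lambda>j. c j * d j) M = mset_weight c M * mset_weight d M"
  by (induction M) (simp_all add: ac_simps)

lemma mset_weight_one: "mset_weight (\<lambda>j. 1) M = 1"
  by (induction M) simp_all

lemma mset_weight_fun_upd: "mset_weight (\<lambda>i. if i = j then z else 1) M = z ^ count M j"
  by (induction M) auto

section \<open>Left-normed monomials\<close>

primrec left_normed :: "magma \<Rightarrow> bool" where
  "left_normed (Gen i) = True"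
| "left_normed (Mul m n) = (left_normed m \<and> (\<exists>j. n = Gen j))"

primrec lead :: "magma \<Rightarrow> nat" where
  "lead (Gen i) = i"
| "lead (Mul m n) = lead m"

text \<open>Meaningful for left-normed monomials only: there \<open>lead n\<close> is the factor \<open>n\<close> itself.\<close>

primrec tail_mset :: "magma \<Rightarrow> nat multiset" where
  "tail_mset (Gen i) = {#}"
| "tail_mset (Mul m n) = add_mset (lead n) (tail_mset m)"

section \<open>T-ideals\<close>

lemma free_leibniz_expand:
  fixes f :: "'k::field free_leibniz"
  shows "f = (\<Sum>m\<in>Poly_Mapping.keys (rep_free_leibniz f).
    fl_scale (Poly_Mapping.lookup (rep_free_leibniz f) m) (fl.eval_magma gen m))"
proof -
  have "alg_hom fl_scale (*) fl_scale (*) (\<lambda>x :: 'k free_leibniz. x)"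
    by (auto simp: alg_hom_def intro!: Vector_Spaces.linear.intro module_hom.intro
        module_hom_axioms.intro fl.vector_space_axioms fl.module_axioms)
  then have "(\<lambda>x :: 'k free_leibniz. x) = fl.subst gen"
    by (rule fl.alg_hom_unique) simp
  then have "f = fl.subst gen f" by metis
  then show ?thesis by (simp add: fl.subst_def fl.eval_na_def)
qed

context leibniz_algebra
begin

lemma subst_mult: "subst \<sigma> (f * g) = subst \<sigma> f \<star> subst \<sigma> g"
  using alg_hom_subst[of \<sigma>] by (simp add: alg_hom_def)

lemma subst_linear: "Vector_Spaces.linear fl_scale scale (subst \<sigma>)"
  using alg_hom_subst[of \<sigma>] by (simp add: alg_hom_def)

lemma subst_diff: "subst \<sigma> (f - g) = subst \<sigma> f - subst \<sigma> g"
  using module_hom.diff[OF Vector_Spaces.linear.axioms(3)[OF subst_linear]] .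

lemma subst_right_power: "subst \<sigma> (right_power x n y) = ((\<lambda>z. z \<star> subst \<sigma> y) ^^ n) (subst \<sigma> x)"
  unfolding right_power_def by (induction n) (simp_all add: subst_mult)

text \<open>An endomorphism followed by a substitution is again a substitution, so endomorphisms
  preserve identities.\<close>

lemma T_ideal_identities: "T_ideal identities"
proof -
  have "fl.subspace {f. subst \<sigma> f = 0}" for \<sigma>
    by (rule module_hom.subspace_kernel[OF Vector_Spaces.linear.axioms(3)[OF subst_linear]])
  then have "fl.ideal identities"
    by (auto simp: fl.ideal_def identities_def fl.subspace_def subst_mult)
  moreover have "\<phi> f \<in> identities"
    if \<phi>: "alg_hom fl_scale (*) fl_scale (*) \<phi>" and f: "f \<in> identities" for \<phi> f
  proof -
    have "alg_hom fl_scale (*) scale (\<star>) (subst \<sigma> \<circ> \<phi>)" for \<sigma>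
      using \<phi> subst_linear[of \<sigma>] by (auto simp: alg_hom_def subst_mult intro: Vector_Spaces.linear_compose)
    then have "subst \<sigma> \<circ> \<phi> = subst (\<lambda>i. (subst \<sigma> \<circ> \<phi>) (gen i))" for \<sigma>
      by (rule alg_hom_unique) simp
    then have "subst \<sigma> (\<phi> f) = subst (\<lambda>i. (subst \<sigma> \<circ> \<phi>) (gen i)) f" for \<sigma>
      by (metis comp_apply)
    then show ?thesis using f by (simp add: identities_def)
  qed
  ultimately show ?thesis by (auto simp: T_ideal_def)
qed

end

lemma T_ideal_subst: "T_ideal I \<Longrightarrow> f \<in> I \<Longrightarrow> fl.subst \<sigma> f \<in> I"
  using fl.alg_hom_subst[of \<sigma>] by (auto simp: T_ideal_def)

section \<open>Congruences modulo a T-ideal containing x(yz)\<close>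

locale right_nil_T_ideal =
  fixes I :: "'k::field free_leibniz set"
  assumes T_ideal: "T_ideal I"
    and gen_mult_mult: "gen 0 * (gen 1 * gen 2) \<in> I"
begin

lemma ideal: "fl.ideal I" and subspace: "fl.subspace I"
  using T_ideal by (auto simp: T_ideal_def fl.ideal_def)

lemma mult_left_mem: "f \<in> I \<Longrightarrow> f * x \<in> I"
  using ideal by (auto simp: fl.ideal_def)

lemma mult_mult_mem: "x * (y * z) \<in> I"
  using T_ideal_subst[OF T_ideal gen_mult_mult, of "\<lambda>i. if i = 0 then x else if i = 1 then y else z"]
  by (simp add: fl.subst_mult fl.subst_gen)

lemma cong_trans: "f - g \<in> I \<Longrightarrow> g - h \<in> I \<Longrightarrow> f - h \<in> I"
  using fl.subspace_add[OF subspace, of "f - g" "g - h"] by simp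

lemma cong_sym: "f - g \<in> I \<Longrightarrow> g - f \<in> I"
  using fl.subspace_neg[OF subspace, of "f - g"] by simp

lemma cong_mult: "f - g \<in> I \<Longrightarrow> f * x - g * x \<in> I"
  using mult_left_mem[of "f - g" x] by (simp add: fl.mult_diff_left)

text \<open>A choice of representatives modulo \<open>I\<close> turns congruences into equations, so that
  right multiplications commute on the nose and can be folded over a multiset.\<close>

definition repr :: "'k free_leibniz \<Rightarrow> 'k free_leibniz" where
  "repr f = (SOME g. f - g \<in> I)"

lemma repr_cong: "f - repr f \<in> I"
  unfolding repr_def by (rule someI[of _ f]) (simp add: fl.subspace_0[OF subspace])

lemma repr_eqI:
  assumes "f - g \<in> I"
  shows "repr f = repr g"
proof -
  have "f - h \<in> I \<longleftrightarrow> g - h \<in> I" for h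
    using assms cong_sym cong_trans by blast
  then show ?thesis by (simp add: repr_def)
qed

definition rmul :: "nat \<Rightarrow> 'k free_leibniz \<Rightarrow> 'k free_leibniz" where
  "rmul j f = repr (f * gen j)"

lemma rmul_cong: "f - g \<in> I \<Longrightarrow> f * gen j - rmul j g \<in> I"
  unfolding rmul_def by (rule cong_trans[OF cong_mult repr_cong])

text \<open>By the Leibniz identity \<open>f * gen i * gen j - f * gen j * gen i\<close> equals
  \<open>f * (gen i * gen j)\<close>, a member of \<open>I\<close>.\<close>

sublocale comp_fun_commute rmul
proof
  fix i j
  have "rmul j (rmul i f) = rmul i (rmul j f)" for f
  proof -
    have *: "rmul j (rmul i f) = repr (f * gen i * gen j)" for i j f
      unfolding rmul_def
      by (rule repr_eqI[symmetric], rule cong_mult, rule repr_cong)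
    show ?thesis
      unfolding * using mult_mult_mem[of f "gen i" "gen j"] by (intro repr_eqI) (simp add: fl.leibniz)
  qed
  then show "rmul j \<circ> rmul i = rmul i \<circ> rmul j" by auto
qed

definition normal_form :: "nat \<Rightarrow> nat multiset \<Rightarrow> 'k free_leibniz" where
  "normal_form i M = fold_mset rmul (gen i) M"

lemma left_normed_cong:
  "left_normed m \<Longrightarrow> fl.eval_magma gen m - normal_form (lead m) (tail_mset m) \<in> I"
proof (induction m)
  case (Gen i)
  show ?case by (simp add: normal_form_def fl.subspace_0[OF subspace])
next
  case (Mul m n)
  then show ?case by (auto simp: normal_form_def intro: rmul_cong)
qed

text \<open>If the right factor is a product, the monomial is an instance of x(yz); otherwise the
  left factor is not left-normed and absorption applies.\<close>

lemma not_left_normed_mem: "\<not> left_normed m \<Longrightarrow> fl.eval_magma gen m \<in> I"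
proof (induction m)
  case (Mul m n)
  then show ?case
    by (cases n) (auto intro: mult_left_mem mult_mult_mem)
qed simp

lemma fold_replicate_cong: "right_power f n (gen j) - fold_mset rmul f (replicate_mset n j) \<in> I"
proof (induction n)
  case 0
  show ?case by (simp add: right_power_def fl.subspace_0[OF subspace])
next
  case (Suc n)
  then show ?case by (simp add: right_power_def rmul_cong)
qed

end

section \<open>Reducing multiplicities, and a membership criterion\<close>

definition reduced :: "'k set \<Rightarrow> nat multiset \<Rightarrow> bool" where
  "reduced F M \<longleftrightarrow> infinite F \<or> (\<forall>j. count M j < card F)"

locale right_nil_field_T_ideal = right_nil_T_ideal I
  for I :: "'k::field free_leibniz set" +
  assumes right_power_gen: "finite (UNIV :: 'k set) \<Longrightarrow>
    right_power (gen 0) (card (UNIV :: 'k set)) (gen 1) - gen 0 * gen 1 \<in> I"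
begin

lemma right_power_cong:
  assumes "finite (UNIV :: 'k set)"
  shows "right_power x (card (UNIV :: 'k set)) y - x * y \<in> I"
proof -
  have "fl.subst (\<lambda>i. if i = 0 then x else y)
      (right_power (gen 0) (card (UNIV :: 'k set)) (gen 1) - gen 0 * gen 1) \<in> I"
    by (rule T_ideal_subst[OF T_ideal right_power_gen[OF assms]])
  then show ?thesis
    by (simp add: fl.subst_diff fl.subst_mult fl.subst_gen fl.subst_right_power
        right_power_def[symmetric])
qed

text \<open>Each step replaces q copies of some \<open>j\<close> by one: x_1x_2^(q) = x_1x_2 keeps
  the class, z^q = z keeps the weight, and the size drops because q is at least 2.\<close>

lemma exists_reduced:
  "\<exists>N. reduced (UNIV :: 'k set) N \<and> normal_form i M - normal_form i N \<in> I \<and>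
    (\<forall>c :: nat \<Rightarrow> 'k. mset_weight c M = mset_weight c N)"
proof (induction "size M" arbitrary: M rule: less_induct)
  case less
  let ?q = "card (UNIV :: 'k set)"
  show ?case
  proof (cases "reduced (UNIV :: 'k set) M")
    case True
    then show ?thesis by (intro exI[of _ M]) (simp add: fl.subspace_0[OF subspace])
  next
    case False
    then have fin: "finite (UNIV :: 'k set)" by (simp add: reduced_def)
    from False obtain j where "?q \<le> count M j" by (auto simp: reduced_def not_less)
    then have "replicate_mset ?q j \<subseteq># M" by (simp add: count_le_replicate_mset_subset_eq)
    then obtain R where M: "M = R + replicate_mset ?q j"
      by (metis subset_mset.le_iff_add add.commute)
    have "card {0, 1 :: 'k} \<le> ?q" by (rule card_mono[OF fin]) simp
    then have "size (add_mset j R) < size M" by (simp add: M)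
    from less.hyps[OF this] obtain N where N: "reduced (UNIV :: 'k set) N"
        "normal_form i (add_mset j R) - normal_form i N \<in> I"
        "\<And>c :: nat \<Rightarrow> 'k. mset_weight c (add_mset j R) = mset_weight c N"
      by auto
    \<comment> \<open>The order of the fold is immaterial, so both monomials arise from the common
      part \<open>f\<close> by multiplying with \<open>gen j\<close> alone.\<close>
    define f where "f = normal_form i R"
    have "normal_form i M = fold_mset rmul f (replicate_mset ?q j)"
      by (simp add: M f_def normal_form_def)
    moreover have "normal_form i (add_mset j R) = rmul j f"
      by (simp add: f_def normal_form_def)
    moreover have "f * gen j - rmul j f \<in> I"
      by (simp add: rmul_cong fl.subspace_0[OF subspace])
    ultimately have "normal_form i M - normal_form i (add_mset j R) \<in> I"
      using fold_replicate_cong[of f ?q j] right_power_cong[OF fin, of f "gen j"]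
        cong_trans cong_sym by metis
    then have "normal_form i M - normal_form i N \<in> I" using N(2) by (rule cong_trans)
    moreover have "mset_weight c M = mset_weight c N" for c :: "nat \<Rightarrow> 'k"
      using N(3)[of c] power_card_UNIV_eq_same[OF fin, of "c j"] by (simp add: M mult.commute)
    ultimately show ?thesis using N(1) by blast
  qed
qed

text \<open>Setting every variable but \<open>j\<close> to 1 leaves a power function whose exponent
  is the multiplicity of \<open>j\<close>.\<close>

lemma reduced_weight_eqD:
  assumes "reduced (UNIV :: 'k set) M" "reduced (UNIV :: 'k set) N"
    and "\<And>c :: nat \<Rightarrow> 'k. mset_weight c M = mset_weight c N"
  shows "M = N"
proof (rule multiset_eqI)
  fix j
  show "count M j = count N j"
  proof (rule power_functions_eqD[where 'k = 'k])
    fix z :: 'k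
    show "z ^ count M j = z ^ count N j"
      using assms(3)[of "\<lambda>i. if i = j then z else 1"] by (simp only: mset_weight_fun_upd)
  qed (use assms in \<open>auto simp: reduced_def\<close>)
qed

lemma normal_form_cong:
  assumes "\<And>c :: nat \<Rightarrow> 'k. mset_weight c M = mset_weight c N"
  shows "normal_form i M - normal_form i N \<in> I"
proof -
  obtain M' where M': "reduced (UNIV :: 'k set) M'" "normal_form i M - normal_form i M' \<in> I"
      "\<And>c :: nat \<Rightarrow> 'k. mset_weight c M = mset_weight c M'"
    using exists_reduced by blast
  obtain N' where N': "reduced (UNIV :: 'k set) N'" "normal_form i N - normal_form i N' \<in> I"
      "\<And>c :: nat \<Rightarrow> 'k. mset_weight c N = mset_weight c N'"
    using exists_reduced by blast
  have "M' = N'"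
    by (rule reduced_weight_eqD[OF M'(1) N'(1)]) (metis assms M'(3) N'(3))
  then show ?thesis using M'(2) N'(2) cong_trans cong_sym by metis
qed

text \<open>Left-normed monomials are grouped by leading variable and weight function. Independence
  makes the coefficients in each group sum to 0, and the members of a group are congruent, so each
  group contributes an element of \<open>I\<close>.\<close>

lemma memI:
  fixes f :: "'k free_leibniz"
  defines "p \<equiv> rep_free_leibniz f"
  assumes zero: "\<And>i c.
    (\<Sum>m | m \<in> Poly_Mapping.keys p \<and> left_normed m \<and> lead m = i.
       Poly_Mapping.lookup p m * mset_weight (c :: nat \<Rightarrow> 'k) (tail_mset m)) = 0"
  shows "f \<in> I"
proof -
  define a where "a = Poly_Mapping.lookup p"
  define S where "S = {m \<in> Poly_Mapping.keys p. left_normed m}"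
  define \<chi> where "\<chi> m = (\<lambda>c :: nat \<Rightarrow> 'k. mset_weight c (tail_mset m))" for m
  define \<mu> where "\<mu> = (fl.eval_magma gen :: magma \<Rightarrow> 'k free_leibniz)"
  have fin: "finite S" by (simp add: S_def)
  have coeff: "(\<Sum>m | m \<in> S \<and> (lead m, \<chi> m) = (i, \<psi>). a m) = 0" for i \<psi>
  proof (cases "\<psi> \<in> \<chi> ` {m \<in> S. lead m = i}")
    case True
    define B where "B = {m \<in> S. lead m = i}"
    \<comment> \<open>Different monomials may share a weight function, so the relation is regrouped
      over the distinct functions.\<close>
    have "(\<Sum>m | m \<in> B \<and> \<chi> m = \<psi>. a m) = 0"
    proof (rule multiplicative_functions_independent[where A = "\<chi> ` B"
          and op = "\<lambda>c d j. c j * d j" and g = "\<lambda>\<psi>. \<Sum>m | m \<in> B \<and> \<chi> m = \<psi>. a m"])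
      fix c
      have "(\<Sum>\<psi>\<in>\<chi> ` B. (\<Sum>m | m \<in> B \<and> \<chi> m = \<psi>. a m) * \<psi> c) =
          (\<Sum>\<psi>\<in>\<chi> ` B. \<Sum>m | m \<in> B \<and> \<chi> m = \<psi>. a m * \<chi> m c)"
        by (simp add: sum_distrib_right)
      also have "\<dots> = (\<Sum>m\<in>B. a m * \<chi> m c)"
        using fin by (intro sum.image_gen[symmetric]) (simp add: B_def)
      also have "\<dots> = 0"
        using zero[of c i] by (simp add: B_def S_def a_def \<chi>_def conj_assoc)
      finally show "(\<Sum>\<psi>\<in>\<chi> ` B. (\<Sum>m | m \<in> B \<and> \<chi> m = \<psi>. a m) * \<psi> c) = 0" .
    next
      show "\<exists>c. \<psi> c \<noteq> 0" if "\<psi> \<in> \<chi> ` B" for \<psi>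
        using that by (auto simp: \<chi>_def intro!: exI[of _ "\<lambda>_. 1"] simp: mset_weight_one)
    qed (use True fin in \<open>auto simp: B_def \<chi>_def mset_weight_mult\<close>)
    then show ?thesis by (simp add: B_def conj_assoc)
  next
    case False
    then have "{m \<in> S. (lead m, \<chi> m) = (i, \<psi>)} = {}" by auto
    then show ?thesis by (simp only: sum.empty)
  qed
  have \<mu>: "\<mu> m - \<mu> n \<in> I" if "m \<in> S" "n \<in> S" "lead m = lead n" "\<chi> m = \<chi> n" for m n
  proof -
    have "normal_form (lead n) (tail_mset m) - normal_form (lead n) (tail_mset n) \<in> I"
      by (rule normal_form_cong) (use that(4) in \<open>metis \<chi>_def\<close>)
    moreover have "\<mu> m - normal_form (lead n) (tail_mset m) \<in> I"
      "\<mu> n - normal_form (lead n) (tail_mset n) \<in> I"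
      using left_normed_cong that by (auto simp: S_def \<mu>_def) metis
    ultimately show ?thesis using cong_trans cong_sym by blast
  qed
  have group: "(\<Sum>m | m \<in> S \<and> (lead m, \<chi> m) = k. fl_scale (a m) (\<mu> m)) \<in> I"
    if "k \<in> (\<lambda>m. (lead m, \<chi> m)) ` S" for k
  proof -
    define B where "B = {m \<in> S. (lead m, \<chi> m) = k}"
    from that obtain n where n: "n \<in> B" by (auto simp: B_def)
    have "(\<Sum>m\<in>B. a m) = 0" using coeff[of "fst k" "snd k"] by (simp add: B_def)
    \<comment> \<open>As the coefficients sum to 0, subtracting the fixed \<open>\<mu> n\<close>
      from every term changes nothing.\<close>
    then have "(\<Sum>m\<in>B. fl_scale (a m) (\<mu> m)) = (\<Sum>m\<in>B. fl_scale (a m) (\<mu> m - \<mu> n))"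
      by (simp add: fl.scale_right_diff_distrib sum_subtractf flip: fl.scale_sum_left)
    also have "\<dots> \<in> I"
      using n by (intro fl.subspace_sum[OF subspace] fl.subspace_scale[OF subspace] \<mu>)
        (auto simp: B_def)
    finally show ?thesis by (simp add: B_def)
  qed
  have "(\<Sum>m\<in>S. fl_scale (a m) (\<mu> m)) \<in> I"
    unfolding sum.image_gen[OF fin, where g = "\<lambda>m. (lead m, \<chi> m)"]
    by (rule fl.subspace_sum[OF subspace]) (rule group)
  moreover have "(\<Sum>m\<in>Poly_Mapping.keys p - S. fl_scale (a m) (\<mu> m)) \<in> I"
    by (intro fl.subspace_sum[OF subspace] fl.subspace_scale[OF subspace])
      (auto simp: S_def \<mu>_def not_left_normed_mem)
  moreover have "f = (\<Sum>m\<in>Poly_Mapping.keys p. fl_scale (a m) (\<mu> m))"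
    unfolding p_def a_def \<mu>_def by (rule free_leibniz_expand)
  then have "f = (\<Sum>m\<in>Poly_Mapping.keys p - S. fl_scale (a m) (\<mu> m))
      + (\<Sum>m\<in>S. fl_scale (a m) (\<mu> m))"
    by (subst (asm) sum.subset_diff[of S]) (auto simp: S_def)
  ultimately show ?thesis using fl.subspace_add[OF subspace] by metis
qed

end

section \<open>The algebra \<open>L\<^sub>1\<^sub>1\<close>\<close>

context L11
begin

lemma coordinates: obtains a b c where "x = a *s e1 + b *s e2 + c *s e3"
proof -
  have "x \<in> span {e1, e2, e3}" by (simp add: span_basis)
  then obtain a b c where "x - a *s e1 - b *s e2 - c *s e3 = 0"
    by (auto simp: span_insert)
  then show ?thesis using that[of a b c] by (simp add: algebra_simps)
qed

lemmas mult_basis = mult_add_left mult_add_right mult_scale_left mult_scale_right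
  e1_products e2_products e3_products

lemma mult_e1 [simp]: "x \<star> e1 = 0"
  by (cases x rule: coordinates) (simp add: mult_basis)

lemma mult_e2 [simp]: "x \<star> e2 = 0"
  by (cases x rule: coordinates) (simp add: mult_basis)

lemma mult_e3_e3 [simp]: "(x \<star> e3) \<star> e3 = x \<star> e3"
  by (cases x rule: coordinates) (simp add: mult_basis)

text \<open>Products lie in the span of \<open>e1\<close> and \<open>e2\<close>, and right
  multiplication by either is zero.\<close>

lemma mult_mult_zero [simp]: "x \<star> (y \<star> z) = 0"
  by (cases y rule: coordinates; cases z rule: coordinates)
    (simp add: mult_basis)

text \<open>Only the \<open>e3\<close> coordinate of \<open>y\<close> acts from the right, and
  \<open>x \<star> e3\<close> is fixed by right multiplication by \<open>e3\<close>. The 0th iterate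
  is \<open>x\<close> itself, hence \<open>Suc n\<close>.\<close>

lemma funpow_mult:
  assumes "y = a *s e1 + b *s e2 + c *s e3"
  shows "((\<lambda>z. z \<star> y) ^^ Suc n) x = c ^ Suc n *s (x \<star> e3)"
proof (induction n)
  case 0
  show ?case by (simp add: assms mult_add_right mult_scale_right)
next
  case (Suc n)
  then show ?case by (simp add: assms mult_add_right mult_scale_right mult_scale_left mult.commute)
qed

lemma mult_mult_identity: "gen 0 * (gen 1 * gen 2) \<in> identities"
  by (simp add: identities_def subst_mult)

lemma right_power_identity:
  assumes "finite (UNIV :: 'k set)"
  shows "right_power (gen 0) (card (UNIV :: 'k set)) (gen 1) - gen 0 * gen 1 \<in> identities"
proof -
  obtain n where n: "card (UNIV :: 'k set) = Suc n"
    using assms by (metis card_gt_0_iff UNIV_not_empty gr0_implies_Suc)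
  have "((\<lambda>z. z \<star> y) ^^ card (UNIV :: 'k set)) x = x \<star> y" for x y
  proof (cases y rule: coordinates)
    case (1 a b c)
    have "((\<lambda>z. z \<star> y) ^^ card (UNIV :: 'k set)) x = c *s (x \<star> e3)"
      using funpow_mult[OF 1, of n x] power_card_UNIV_eq_same[OF assms, of c] by (simp only: n)
    then show ?thesis by (simp add: 1 mult_add_right mult_scale_right)
  qed
  then show ?thesis
    by (simp add: identities_def subst_diff subst_mult subst_right_power)
qed

text \<open>A right factor \<open>Gen j\<close> acts as \<open>c j\<close> times right
  multiplication by \<open>e3\<close>, and a product there acts as zero. The final \<open>e3\<close>
  removes the \<open>e3\<close> component of a single variable.\<close>

lemma eval_magma_mult_e3:
  fixes c :: "nat \<Rightarrow> 'k" and i :: nat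
  defines "\<sigma> \<equiv> \<lambda>j. (if j = i then e1 else 0) + c j *s e3"
  shows "eval_magma \<sigma> m \<star> e3 =
    (if left_normed m \<and> lead m = i then mset_weight c (tail_mset m) else 0) *s e1"
proof (induction m)
  case (Gen j)
  show ?case by (simp add: \<sigma>_def mult_basis)
next
  case (Mul m n)
  show ?case
  proof (cases n)
    case (Gen j)
    have "eval_magma \<sigma> m \<star> \<sigma> j = c j *s (eval_magma \<sigma> m \<star> e3)"
      by (simp add: \<sigma>_def mult_basis)
    then show ?thesis using Mul.IH(1) Gen by (simp add: mult_scale_left e1_products)
  qed simp
qed

text \<open>The sum is the \<open>e1\<close> coefficient of the value of \<open>f\<close> multiplied
  by \<open>e3\<close>; its vanishing is what \<open>memI\<close> asks for.\<close>

lemma identity_coefficients: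
  fixes f :: "'k free_leibniz"
  defines "p \<equiv> rep_free_leibniz f"
  assumes "f \<in> identities"
  shows "(\<Sum>m | m \<in> Poly_Mapping.keys p \<and> left_normed m \<and> lead m = i.
    Poly_Mapping.lookup p m * mset_weight c (tail_mset m)) = 0"
proof -
  define \<sigma> where "\<sigma> j = (if j = i then e1 else 0) + c j *s e3" for j
  let ?w = "\<lambda>m. if left_normed m \<and> lead m = i then mset_weight c (tail_mset m) else 0"
  have "eval_na \<sigma> p = 0"
    using assms by (simp add: identities_def subst_def)
  then have "0 = (\<Sum>m\<in>Poly_Mapping.keys p. Poly_Mapping.lookup p m *s eval_magma \<sigma> m) \<star> e3"
    by (simp add: eval_na_def)
  also have "\<dots> = (\<Sum>m\<in>Poly_Mapping.keys p. (Poly_Mapping.lookup p m * ?w m) *s e1)"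
    unfolding mult_sum_left mult_scale_left \<sigma>_def eval_magma_mult_e3 by simp
  also have "\<dots> = (\<Sum>m\<in>Poly_Mapping.keys p. Poly_Mapping.lookup p m * ?w m) *s e1"
    by (simp add: scale_sum_left)
  \<comment> \<open>Independence of the basis gives that \<open>e1\<close> is nonzero.\<close>
  finally have "(\<Sum>m\<in>Poly_Mapping.keys p. Poly_Mapping.lookup p m * ?w m) = 0"
    using independent_basis dependent_zero[of "{e1, e2, e3}"] by auto
  then show ?thesis
    by (simp add: sum.inter_filter if_distrib cong: if_cong)
qed

lemma identities_subset:
  assumes "right_nil_field_T_ideal I"
  shows "identities \<subseteq> I"
  by (intro subsetI right_nil_field_T_ideal.memI[OF assms] identity_coefficients)

end

theorem theorem3p18:
  fixes scale :: "'k::field \<Rightarrow> 'a::ab_group_add \<Rightarrow> 'a"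
    and mult :: "'a \<Rightarrow> 'a \<Rightarrow> 'a"
    and e1 e2 e3 :: 'a
  assumes "L11 scale mult e1 e2 e3"
  shows "(infinite (UNIV :: 'k set) \<longrightarrow>
           nonassoc_algebra.identities scale mult
             = T_ideal_generated {gen 0 * (gen 1 * gen 2)}) \<and>
         (\<forall>q. finite (UNIV :: 'k set) \<and> card (UNIV :: 'k set) = q \<longrightarrow>
           nonassoc_algebra.identities scale mult
             = T_ideal_generated {gen 0 * (gen 1 * gen 2),
                 right_power (gen 0) q (gen 1) - gen 0 * gen 1})"
proof -
  interpret L11 scale mult e1 e2 e3 by (rule assms)
  \<comment> \<open>One inclusion is minimality of the generated T-ideal, the other is
    \<open>identities_subset\<close>.\<close>
  have generated: "identities = T_ideal_generated S"
    if S: "S \<subseteq> identities" and I: "right_nil_field_T_ideal (T_ideal_generated S)" for S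
  proof
    show "T_ideal_generated S \<subseteq> identities"
      unfolding T_ideal_generated_def by (intro hull_minimal S T_ideal_identities)
  qed (rule identities_subset[OF I])
  have mem: "s \<in> S \<Longrightarrow> s \<in> T_ideal_generated S" for s :: "'k free_leibniz" and S
    unfolding T_ideal_generated_def by (rule hull_inc)
  show ?thesis
  proof (intro conjI allI impI; (elim conjE)?)
    assume "infinite (UNIV :: 'k set)"
    then show "identities = T_ideal_generated {gen 0 * (gen 1 * gen 2)}"
      by (intro generated right_nil_field_T_ideal.intro right_nil_T_ideal.intro
          right_nil_field_T_ideal_axioms.intro T_ideal_T_ideal_generated mem)
        (simp_all add: mult_mult_identity del: One_nat_def)
  next
    fix q
    assume "finite (UNIV :: 'k set)" "card (UNIV :: 'k set) = q"
    then show "identities = T_ideal_generated {gen 0 * (gen 1 * gen 2),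
        right_power (gen 0) q (gen 1) - gen 0 * gen 1}"
      by (intro generated right_nil_field_T_ideal.intro right_nil_T_ideal.intro
          right_nil_field_T_ideal_axioms.intro T_ideal_T_ideal_generated mem)
        (use mult_mult_identity right_power_identity in \<open>auto simp del: One_nat_def\<close>)
  qed
qed

end
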